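(* Let $g\ge1$ be an integer, $\mathcal A$ a $g$-admissible set of multi-indexes, and $$\mathbf V=\bigoplus_{I\in\mathcal A}\ \bigoplus_{m=0}^{g-s(I)-2d(I)}\mathbb Q\,\lambda_I^{[m]}$$ the $\mathbb Q$-vector space with basis the symbols $\lambda_I^{[m]}$, endowed with the two graduations in which $\lambda_I^{[m]}$ has degree $s(I)$ and dimension $d(I)+m$, respectively. Put $\lambda_I^{[m]}=0$ if $I\notin\mathcal A$ or $m\notin[0,g-s(I)-2d(I)]$, and $\lambda_I=\lambda_I^{[0]}$. Suppose given commutative $\mathbf V$-valued "basic" products $\lambda_I\star\lambda_J$ ($I,J\in\mathcal A$), homogeneous with respect to both graduations (i.e. $\lambda_I\star\lambda_J$ lies in degree $s(I)+s(J)$ and dimension $d(I)+d(J)$), with $\lambda_\emptyset\star\lambda_I=\lambda_I$ for all $I$. Extend $\star$ bilinearly to $\mathbf V$ by setting, on basis elements, (a) $\lambda_\emptyset^{[k]}\star\lambda_I^{[m]}=\binom{m+k}{m}\lambda_I^{[m+k]}$; (b) $\lambda_I^{[m]}\star\lambda_J^{[h]}=\binom{m+h}{m}\,\lambda_\emptyset^{[m+h]}\star(\lambda_I\star\lambda_J)$. Assume that $(\lambda_I\star\lambda_J)\star\lambda_R=\lambda_I\star(\lambda_J\star\lambda_R)$ for all $I,J,R\in\mathcal A$. Then there exist bilinear products $\star$ (extending the given basic products by (a), (b)) and $\cdot$ on $\mathbf V$ and a linear endomorphism $\mathcal F$ of $\mathbf V$ such that properties (P1)–(P9) listed in the context hold.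 Furthermore such $\star$, $\cdot$ and $\mathcal F$ are unique.
   Context: $\mathcal J$ is the family of finite multisets $I=\{i_1,\dots,i_d\}$ of strictly positive integers (including $\emptyset$), $d(I)=d$ is the cardinality with multiplicity, $s(I)=i_1+\dots+i_d$. A set $\mathcal A$ is $g$-admissible if $\emptyset\in\mathcal A\subseteq\mathcal J$; $s(I)+2d(I)\le g$ for all $I\in\mathcal A$; and $I\in\mathcal A$ implies $J\in\mathcal A$ for every sub-multiset $J\subseteq I$. For $n\in\mathbb Z$, $\mathrm{mult}(n)_*$ and $\mathrm{mult}(n)^*$ denote the linear operators on $\mathbf V$ multiplying $\lambda_I^{[m]}$ by $n^{2d(I)+2m+s(I)}$ and by $n^{2g-2d(I)-2m-s(I)}$ respectively; $W^-=\mathrm{mult}(-1)^*W$. $[\mathbf V_d]_s$ is the span of the $\lambda_I^{[m]}$ with $d(I)+m=d$, $s(I)=s$. In the model, $\Theta:=\lambda_\emptyset^{[g-1]}$, $e^{\pm\Theta}:=\sum_{k=0}^g(\pm1)^k\lambda_\emptyset^{[g-k]}$ (representing $\sum_k(\pm\Theta)^k/k!$). Properties (for basis elements $\lambda_I^{[m]},\lambda_J^{[h]}$, etc., with $I,J\in\mathcal A$ and exponents in the allowed ranges, and all $\alpha,\beta,W\in\mathbf V$): (P1) $\mathcal F(\alpha\star\beta)=\mathcal F(\alpha)\cdot\mathcal F(\beta)$ and $\mathcal F(\alpha\cdot\beta)=(-1)^g\mathcal F(\alpha)\star\mathcal F(\beta)$; (P2) $\mathcal F\circ\mathcal F=(-1)^g\,\mathrm{mult}(-1)^*$;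 (P3) $\mathcal F\,[\mathbf V_d]_s=[\mathbf V_{g-d-s}]_s$; (P4) $\mathcal F(W)=e^{\Theta}\cdot\big[(W^-\cdot e^{\Theta})\star e^{-\Theta}\big]$; (P5) $s(I)+2d(I)\le g$ whenever $\lambda_I\neq0$; (P6) for $I\in\mathcal A$, $\lambda_I^{[m]}\ne0$ if and only if $0\le m\le g-s(I)-2d(I)$; (P7) $\mathcal F(\lambda_I^{[m]})=(-1)^m\lambda_I^{[g-s(I)-2d(I)-m]}$; (P8) $\lambda_\emptyset^{[k]}\star\lambda_I^{[m]}=\binom{m+k}{m}\lambda_I^{[m+k]}$ and $\lambda_\emptyset^{[k]}\cdot\lambda_I^{[m]}=\binom{2g-m-k-s(I)-2d(I)}{g-k}\lambda_I^{[m-g+k]}$; (P9) $\lambda_I^{[m]}\star\lambda_J^{[h]}=\binom{m+h}{m}\lambda_\emptyset^{[m+h]}\star(\lambda_I\star\lambda_J)$ and $\lambda_I^{[t]}\cdot\lambda_J^{[k]}=\binom{i'-t+j'-k}{i'-t}\lambda_\emptyset^{[g-i'+t-j'+k]}\cdot\big(\lambda_I^{[i']}\cdot\lambda_J^{[j']}\big)$, where $i'=g-s(I)-2d(I)$, $j'=g-s(J)-2d(J)$. ($\lambda_\emptyset^{[n]}=0$ for $n<0$ or $n>g$.) *)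

theory Defs
  imports Complex_Main "HOL-Library.Multiset" "HOL-Library.Poly_Mapping"
begin

text \<open>
  For a multi-index \<open>I :: nat multiset\<close>, \<open>d(I)\<close> is \<open>size I\<close> and \<open>s(I)\<close> is \<open>sum_mset I\<close>.
\<close>

definition admissible :: "nat \<Rightarrow> nat multiset set \<Rightarrow> bool" where
  "admissible g A \<longleftrightarrow>
     {#} \<in> A \<and>
     (\<forall>I\<in>A. \<forall>i\<in>#I. 0 < i) \<and>
     (\<forall>I\<in>A. sum_mset I + 2 * size I \<le> g) \<and>
     (\<forall>I\<in>A. \<forall>J. J \<subseteq># I \<longrightarrow> J \<in> A)"

text \<open>
  The free rational vector space on all symbols \<open>(I, m)\<close> is the type of finitely supported
  functions; the space attached to \<open>g\<close> and \<open>A\<close> is its subspace of the functions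
  supported on the symbols with \<open>I \<in> A\<close> and \<open>0 \<le> m \<le> g - s(I) - 2 d(I)\<close>.
\<close>

type_synonym qvec = "nat multiset \<times> nat \<Rightarrow>\<^sub>0 rat"

definition qscale :: "rat \<Rightarrow> qvec \<Rightarrow> qvec" where
  "qscale c = Poly_Mapping.map ((*) c)"

lemma lookup_qscale: "Poly_Mapping.lookup (qscale c v) p = c * Poly_Mapping.lookup v p"
  by (simp add: qscale_def Poly_Mapping.map.rep_eq when_def)

global_interpretation qvec: vector_space qscale
  by standard
    (auto intro!: poly_mapping_eqI simp: lookup_qscale lookup_add algebra_simps)

definition basis_symbols :: "nat \<Rightarrow> nat multiset set \<Rightarrow> (nat multiset \<times> nat) set" where
  "basis_symbols g A = {(I, m). I \<in> A \<and> m + sum_mset I + 2 * size I \<le> g}"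

definition V :: "nat \<Rightarrow> nat multiset set \<Rightarrow> qvec set" where
  "V g A = {v. Poly_Mapping.keys v \<subseteq> basis_symbols g A}"

text \<open>
  The exponent is an integer, so that symbols whose exponent is negative or too large are
  zero, as are those with \<open>I \<notin> A\<close>.
\<close>

definition lam :: "nat \<Rightarrow> nat multiset set \<Rightarrow> nat multiset \<Rightarrow> int \<Rightarrow> qvec" where
  "lam g A I m =
     (if 0 \<le> m \<and> (I, nat m) \<in> basis_symbols g A then Poly_Mapping.single (I, nat m) 1 else 0)"

text \<open>The bihomogeneous piece of dimension \<open>d(I) + m = d\<close> and degree \<open>s(I) = s\<close>.\<close>

definition graded :: "nat \<Rightarrow> nat multiset set \<Rightarrow> int \<Rightarrow> int \<Rightarrow> qvec set" where
  "graded g A d s =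
     qvec.span {lam g A I m | I m. I \<in> A \<and> int (size I) + m = d \<and> int (sum_mset I) = s}"

text \<open>
  Maps on the space are functions on the whole type of which only the values on \<open>V g A\<close> matter.
\<close>

definition linear_on :: "qvec set \<Rightarrow> (qvec \<Rightarrow> qvec) \<Rightarrow> bool" where
  "linear_on U F \<longleftrightarrow>
     (\<forall>v\<in>U. F v \<in> U) \<and>
     (\<forall>v\<in>U. \<forall>w\<in>U. F (v + w) = F v + F w) \<and>
     (\<forall>c. \<forall>v\<in>U. F (qscale c v) = qscale c (F v))"

definition bilinear_on :: "qvec set \<Rightarrow> (qvec \<Rightarrow> qvec \<Rightarrow> qvec) \<Rightarrow> bool" where
  "bilinear_on U B \<longleftrightarrow>
     (\<forall>v\<in>U. linear_on U (B v)) \<and> (\<forall>w\<in>U. linear_on U (\<lambda>v. B v w))"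

text \<open>
  The operator usually written \<open>mult(n)\<^sup>*\<close>. On the symbols of \<open>V g A\<close> the subtraction in
  the exponent does not truncate, since \<open>2 d(I) + 2 m + s(I) \<le> 2 (m + s(I) + 2 d(I)) \<le> 2 g\<close>.
\<close>

definition mult_upper :: "nat \<Rightarrow> int \<Rightarrow> qvec \<Rightarrow> qvec" where
  "mult_upper g n =
     Poly_Mapping.mapp
       (\<lambda>(I, m) c. of_int n ^ (2 * g - 2 * size I - 2 * m - sum_mset I) * c)"

text \<open>\<open>exp_Theta g A 1\<close> and \<open>exp_Theta g A (- 1)\<close> are \<open>e\<^sup>\<Theta>\<close> and its inverse.\<close>

definition exp_Theta :: "nat \<Rightarrow> nat multiset set \<Rightarrow> rat \<Rightarrow> qvec" where
  "exp_Theta g A \<epsilon> = (\<Sum>k=0..g. qscale (\<epsilon> ^ k) (lam g A {#} (int g - int k)))"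

definition basic_products ::
  "nat \<Rightarrow> nat multiset set \<Rightarrow> (nat multiset \<Rightarrow> nat multiset \<Rightarrow> qvec) \<Rightarrow> bool" where
  "basic_products g A b \<longleftrightarrow>
     (\<forall>I\<in>A. \<forall>J\<in>A. b I J = b J I) \<and>
     (\<forall>I\<in>A. \<forall>J\<in>A.
        b I J \<in> graded g A (int (size I) + int (size J)) (int (sum_mset I) + int (sum_mset J))) \<and>
     (\<forall>I\<in>A. b {#} I = lam g A I 0)"

text \<open>
  Bilinearity and the two rules below determine the extension on \<open>V g A\<close> uniquely.
\<close>

locale extends_basic_products =
  fixes g :: nat and A :: "nat multiset set"
    and b :: "nat multiset \<Rightarrow> nat multiset \<Rightarrow> qvec"
    and star :: "qvec \<Rightarrow> qvec \<Rightarrow> qvec" (infixl "\<star>" 70)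
  assumes bilinear_star: "bilinear_on (V g A) (\<star>)"
    and star_basic: "\<lbrakk>I \<in> A; J \<in> A\<rbrakk> \<Longrightarrow> lam g A I 0 \<star> lam g A J 0 = b I J"
    and star_unit:
      "\<lbrakk>({#}, k) \<in> basis_symbols g A; (I, m) \<in> basis_symbols g A\<rbrakk> \<Longrightarrow>
        lam g A {#} (int k) \<star> lam g A I (int m) =
          qscale (of_nat ((m + k) choose m)) (lam g A I (int m + int k))"
    and star_lam:
      "\<lbrakk>(I, m) \<in> basis_symbols g A; (J, h) \<in> basis_symbols g A\<rbrakk> \<Longrightarrow>
        lam g A I (int m) \<star> lam g A J (int h) =
          qscale (of_nat ((m + h) choose m))
            (lam g A {#} (int m + int h) \<star> (lam g A I 0 \<star> lam g A J 0))"

text \<open>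
  All natural number subtractions below are between quantities for which they do not truncate,
  \<open>g\<close> and \<open>A\<close> being admissible. Subtractions that may become negative occur only in
  the integer exponents of \<open>lam\<close>. The formulas \<open>unit_star_lam\<close> and \<open>lam_star_lam\<close> repeat
  the extension rules \<open>star_unit\<close> and \<open>star_lam\<close>, being also part of the list of properties.
\<close>

locale fourier_structure = extends_basic_products g A b star
  for g :: nat and A :: "nat multiset set"
    and b :: "nat multiset \<Rightarrow> nat multiset \<Rightarrow> qvec"
    and star :: "qvec \<Rightarrow> qvec \<Rightarrow> qvec" (infixl "\<star>" 70) +
  fixes prd :: "qvec \<Rightarrow> qvec \<Rightarrow> qvec" (infixl "\<odot>" 70)
    and F :: "qvec \<Rightarrow> qvec"
  assumes bilinear_prd: "bilinear_on (V g A) (\<odot>)"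
    and linear_F: "linear_on (V g A) F"
    and F_star: "\<lbrakk>\<alpha> \<in> V g A; \<beta> \<in> V g A\<rbrakk> \<Longrightarrow> F (\<alpha> \<star> \<beta>) = F \<alpha> \<odot> F \<beta>"
    and F_prd:
      "\<lbrakk>\<alpha> \<in> V g A; \<beta> \<in> V g A\<rbrakk> \<Longrightarrow> F (\<alpha> \<odot> \<beta>) = qscale ((-1) ^ g) (F \<alpha> \<star> F \<beta>)"
    and F_F: "W \<in> V g A \<Longrightarrow> F (F W) = qscale ((-1) ^ g) (mult_upper g (-1) W)"
    and F_graded: "F ` graded g A d s = graded g A (int g - d - s) s"
    and F_exp:
      "W \<in> V g A \<Longrightarrow>
        F W = exp_Theta g A 1 \<odot>
          ((mult_upper g (-1) W \<odot> exp_Theta g A 1) \<star> exp_Theta g A (-1))"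
    and lam_nonzero_bound:
      "\<lbrakk>\<forall>i\<in>#I. 0 < i; lam g A I 0 \<noteq> 0\<rbrakk> \<Longrightarrow> sum_mset I + 2 * size I \<le> g"
    and lam_nonzero_iff:
      "I \<in> A \<Longrightarrow>
        lam g A I m' \<noteq> 0 \<longleftrightarrow> 0 \<le> m' \<and> m' \<le> int g - int (sum_mset I) - 2 * int (size I)"
    and F_lam:
      "(I, m) \<in> basis_symbols g A \<Longrightarrow>
        F (lam g A I (int m)) =
          qscale ((-1) ^ m) (lam g A I (int g - int (sum_mset I) - 2 * int (size I) - int m))"
    and unit_star_lam:
      "\<lbrakk>({#}, k) \<in> basis_symbols g A; (I, m) \<in> basis_symbols g A\<rbrakk> \<Longrightarrow>
        lam g A {#} (int k) \<star> lam g A I (int m) =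
          qscale (of_nat ((m + k) choose m)) (lam g A I (int m + int k))"
    and unit_prd_lam:
      "\<lbrakk>({#}, k) \<in> basis_symbols g A; (I, m) \<in> basis_symbols g A\<rbrakk> \<Longrightarrow>
        lam g A {#} (int k) \<odot> lam g A I (int m) =
          qscale (of_nat ((2 * g - m - k - sum_mset I - 2 * size I) choose (g - k)))
            (lam g A I (int m - int g + int k))"
    and lam_star_lam:
      "\<lbrakk>(I, m) \<in> basis_symbols g A; (J, h) \<in> basis_symbols g A\<rbrakk> \<Longrightarrow>
        lam g A I (int m) \<star> lam g A J (int h) =
          qscale (of_nat ((m + h) choose m))
            (lam g A {#} (int m + int h) \<star> (lam g A I 0 \<star> lam g A J 0))"
    and lam_prd_lam:
      "\<lbrakk>(I, t) \<in> basis_symbols g A; (J, k) \<in> basis_symbols g A;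
        i' = g - sum_mset I - 2 * size I; j' = g - sum_mset J - 2 * size J\<rbrakk> \<Longrightarrow>
        lam g A I (int t) \<odot> lam g A J (int k) =
          qscale (of_nat ((i' - t + (j' - k)) choose (i' - t)))
            (lam g A {#} (int g - int i' + int t - int j' + int k) \<odot>
              (lam g A I (int i') \<odot> lam g A J (int j')))"

end

(*
  Both products and the Fourier map are prescribed on the basis, the second product being the
  conjugate of the first one by the Fourier map; so they are unique, and only the compatibility
  of these prescriptions is at stake. The one identity with content is the exponential formula
  for the Fourier map. It expresses, in each representation spanned by the symbols with a fixed
  multi-index, the Weyl element of SL2 as a product of three unipotents; it is checked by viewing
  these symbols as the divided monomials of binary forms.
*)

theory Submission
  imports Defs "HOL-Computational_Algebra.Polynomial"
begin

text \<open>This rule would push \<open>int\<close> inside the multiset sum; without it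
  \<open>int (sum_mset I)\<close> stays an atom for linear arithmetic.\<close>

declare of_nat_sum_mset [simp del]

section \<open>The space spanned by the symbols\<close>

lemma qvec_eq_sum_single:
  fixes v :: qvec
  shows "v = (\<Sum>p\<in>Poly_Mapping.keys v. qscale (Poly_Mapping.lookup v p) (Poly_Mapping.single p 1))"
  by (rule poly_mapping_eqI)
    (simp add: lookup_sum lookup_qscale lookup_single when_def in_keys_iff if_distrib
      cong: if_cong)

lemma V_eq_span: "V g A = qvec.span ((\<lambda>p. Poly_Mapping.single p 1) ` basis_symbols g A)"
proof (intro equalityI subsetI)
  fix v assume "v \<in> V g A"
  then have "(\<Sum>p\<in>Poly_Mapping.keys v. qscale (Poly_Mapping.lookup v p) (Poly_Mapping.single p 1))
      \<in> qvec.span ((\<lambda>p. Poly_Mapping.single p 1) ` basis_symbols g A)"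
    by (intro qvec.span_sum qvec.span_scale qvec.span_base imageI) (auto simp: V_def)
  then show "v \<in> qvec.span ((\<lambda>p. Poly_Mapping.single p 1) ` basis_symbols g A)"
    by (subst qvec_eq_sum_single)
next
  fix v assume "v \<in> qvec.span ((\<lambda>p. Poly_Mapping.single p 1) ` basis_symbols g A)"
  then show "v \<in> V g A"
  proof (induction rule: qvec.span_induct_alt)
    case base
    then show ?case by (simp add: V_def)
  next
    case (step c x y)
    then show ?case
      by (auto simp: V_def in_keys_iff lookup_add lookup_qscale lookup_single when_def
          split: if_splits)
  qed
qed

lemma subspace_V: "qvec.subspace (V g A)"
  by (simp add: V_eq_span)

lemmas V_closed [simp, intro] =
  qvec.subspace_0[OF subspace_V] qvec.subspace_add[OF subspace_V]
  qvec.subspace_scale[OF subspace_V] qvec.subspace_sum[OF subspace_V]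

lemma lam_in_V [simp, intro]: "lam g A I m \<in> V g A"
  by (auto simp: lam_def V_def)

lemma lam_int:
  "lam g A I (int m) = (if (I, m) \<in> basis_symbols g A then Poly_Mapping.single (I, m) 1 else 0)"
  by (simp add: lam_def)

lemma V_induct [consumes 1, case_names zero step]:
  assumes "v \<in> V g A" and "P 0"
    and step: "\<And>c I m w. (I, m) \<in> basis_symbols g A \<Longrightarrow> w \<in> V g A \<Longrightarrow> P w \<Longrightarrow>
      P (qscale c (lam g A I (int m)) + w)"
  shows "P v"
proof -
  have "v \<in> qvec.span ((\<lambda>p. Poly_Mapping.single p 1) ` basis_symbols g A)"
    using assms(1) by (simp add: V_eq_span)
  then have "v \<in> V g A \<and> P v"
  proof (induction rule: qvec.span_induct_alt)
    case base
    then show ?case using assms(2) by simp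
  next
    case (step c x y)
    then obtain I m where "(I, m) \<in> basis_symbols g A" "x = lam g A I (int m)"
      by (auto simp: lam_int)
    with step assms(3) show ?case by auto
  qed
  then show ?thesis ..
qed

lemma graded_subset_V: "graded g A d s \<subseteq> V g A"
  unfolding graded_def by (rule qvec.span_minimal[OF _ subspace_V]) auto

lemma single_one_nonzero: "Poly_Mapping.single p (1 :: rat) \<noteq> 0"
  by (metis lookup_single_eq lookup_zero zero_neq_one)

section \<open>Linear and bilinear maps prescribed on the symbols\<close>

lemma linear_on_zero:
  assumes "linear_on (V g A) F"
  shows "F 0 = 0"
proof -
  have "F (0 + 0) = F 0 + F 0"
    using assms V_closed(1)[of g A] unfolding linear_on_def by blast
  then show ?thesis by simp
qed

lemma linear_on_eq:
  assumes F: "linear_on (V g A) F" and G: "linear_on (V g A) G"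
    and eq: "\<And>I m. (I, m) \<in> basis_symbols g A \<Longrightarrow> F (lam g A I (int m)) = G (lam g A I (int m))"
    and v: "v \<in> V g A"
  shows "F v = G v"
  using v
proof (induction rule: V_induct)
  case zero
  then show ?case using linear_on_zero F G by metis
next
  case (step c I m w)
  then show ?case
    using F G eq V_closed(3)[OF lam_in_V] by (simp add: linear_on_def)
qed

lemma bilinear_on_eq:
  assumes B: "bilinear_on (V g A) B" and C: "bilinear_on (V g A) C"
    and eq: "\<And>I m J h. (I, m) \<in> basis_symbols g A \<Longrightarrow> (J, h) \<in> basis_symbols g A \<Longrightarrow>
      B (lam g A I (int m)) (lam g A J (int h)) = C (lam g A I (int m)) (lam g A J (int h))"
    and v: "v \<in> V g A" and w: "w \<in> V g A"
  shows "B v w = C v w"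
proof (rule linear_on_eq[of g A "\<lambda>v. B v w" "\<lambda>v. C v w", OF _ _ _ v])
  show "linear_on (V g A) (\<lambda>v. B v w)" "linear_on (V g A) (\<lambda>v. C v w)"
    using B C w by (auto simp: bilinear_on_def)
  fix I m assume Im: "(I, m) \<in> basis_symbols g A"
  show "B (lam g A I (int m)) w = C (lam g A I (int m)) w"
  proof (rule linear_on_eq[OF _ _ _ w])
    show "linear_on (V g A) (B (lam g A I (int m)))" "linear_on (V g A) (C (lam g A I (int m)))"
      using B C unfolding bilinear_on_def by blast+
  qed (rule eq[OF Im])
qed

text \<open>Linear on the whole type and not only on \<open>V g A\<close>, so additivity and
  homogeneity need no membership conditions.\<close>

definition extend :: "(nat multiset \<times> nat \<Rightarrow> qvec) \<Rightarrow> qvec \<Rightarrow> qvec" where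
  "extend f v = (\<Sum>p\<in>Poly_Mapping.keys v. qscale (Poly_Mapping.lookup v p) (f p))"

text \<open>Supports may shrink under addition and scaling; summing over a common larger set makes
  the two sides comparable.\<close>

lemma extend_superset:
  assumes "finite S" "Poly_Mapping.keys v \<subseteq> S"
  shows "extend f v = (\<Sum>p\<in>S. qscale (Poly_Mapping.lookup v p) (f p))"
  unfolding extend_def using assms by (intro sum.mono_neutral_left) (auto simp: in_keys_iff)

lemma extend_add: "extend f (v + w) = extend f v + extend f w"
proof -
  let ?S = "Poly_Mapping.keys v \<union> Poly_Mapping.keys w"
  have "Poly_Mapping.keys (v + w) \<subseteq> ?S" by (rule keys_add)
  then show ?thesis
    by (simp add: extend_superset[of ?S] lookup_add qvec.scale_left_distrib sum.distrib)
qed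

lemma extend_qscale: "extend f (qscale c v) = qscale c (extend f v)"
proof -
  have "Poly_Mapping.keys (qscale c v) \<subseteq> Poly_Mapping.keys v"
    by (auto simp: in_keys_iff lookup_qscale)
  then show ?thesis
    by (simp add: extend_superset[of "Poly_Mapping.keys v"] lookup_qscale qvec.scale_sum_right)
qed

lemma extend_single [simp]: "extend f (Poly_Mapping.single p 1) = f p"
  by (simp add: extend_def)

lemma extend_zero [simp]: "extend f 0 = 0"
  by (simp add: extend_def)

lemma extend_in_V: "(\<And>p. f p \<in> V g A) \<Longrightarrow> extend f v \<in> V g A"
  by (auto simp: extend_def)

text \<open>Linearity in the prescribed values; it gives linearity of nested extensions in the inner
  argument.\<close>

lemma extend_fun_add: "extend (\<lambda>p. f p + h p) v = extend f v + extend h v"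
  by (simp add: extend_def qvec.scale_right_distrib sum.distrib)

lemma extend_fun_qscale: "extend (\<lambda>p. qscale c (f p)) v = qscale c (extend f v)"
  by (simp add: extend_def qvec.scale_sum_right mult.commute)

lemma extend_fun_zero: "extend (\<lambda>p. 0) v = 0"
  by (simp add: extend_def)

section \<open>The operator \<open>mult_upper g (-1)\<close>\<close>

lemma lookup_mult_upper:
  "Poly_Mapping.lookup (mult_upper g n v) (I, m) =
    of_int n ^ (2 * g - 2 * size I - 2 * m - sum_mset I) * Poly_Mapping.lookup v (I, m)"
  by (simp add: mult_upper_def lookup_mapp when_def in_keys_iff)

lemma mult_upper_add: "mult_upper g n (v + w) = mult_upper g n v + mult_upper g n w"
  by (rule poly_mapping_eqI) (auto simp: lookup_mult_upper lookup_add algebra_simps)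

lemma mult_upper_qscale: "mult_upper g n (qscale c v) = qscale c (mult_upper g n v)"
  by (rule poly_mapping_eqI) (auto simp: lookup_mult_upper lookup_qscale algebra_simps)

lemma mult_upper_zero [simp]: "mult_upper g n 0 = 0"
  by (rule poly_mapping_eqI) (auto simp: lookup_mult_upper)

lemma minus_one_power_cong: "(even m \<longleftrightarrow> even n) \<Longrightarrow> (-1 :: 'a::ring_1) ^ m = (-1) ^ n"
  by (simp add: minus_one_power_iff)

lemma sign_exponent:
  assumes "2 * d + 2 * m + s \<le> 2 * g"
  shows "(-1 :: 'a::ring_1) ^ (2 * g - (2 * d + 2 * m + s)) = (-1) ^ s"
  by (rule minus_one_power_cong) (use assms in presburger)

text \<open>On a symbol of the space the exponent \<open>2g - 2d - 2m - s\<close> does not truncate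
  and has the parity of \<open>s\<close>. Hence only the degree matters, and the operator commutes
  with every map preserving it.\<close>

lemma mult_upper_lam:
  "mult_upper g (-1) (lam g A I m) = qscale ((-1) ^ sum_mset I) (lam g A I m)"
proof (rule poly_mapping_eqI)
  fix p
  show "Poly_Mapping.lookup (mult_upper g (-1) (lam g A I m)) p =
      Poly_Mapping.lookup (qscale ((-1) ^ sum_mset I) (lam g A I m)) p"
    by (cases p) (auto simp: lookup_mult_upper lookup_qscale lam_def lookup_single when_def
        basis_symbols_def sign_exponent)
qed

lemma minus_one_sq [simp]: "(-1 :: rat) ^ n * (-1) ^ n = 1"
  by (simp flip: power_add)

lemma minus_one_sandwich [simp]: "(-1 :: rat) ^ n * c * (-1) ^ n = c"
  by (metis minus_one_sq mult.commute mult.left_commute mult_1_right)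

lemma mult_upper_mult_upper: "mult_upper g (-1) (mult_upper g (-1) v) = v"
  by (rule poly_mapping_eqI) (auto simp: lookup_mult_upper mult.assoc[symmetric])

lemma mult_upper_graded:
  assumes "v \<in> graded g A d s"
  shows "mult_upper g (-1) v = qscale ((-1) ^ nat s) v"
  using assms unfolding graded_def
proof (induction rule: qvec.span_induct_alt)
  case base
  then show ?case by simp
next
  case (step c x y)
  then show ?case
    by (auto simp: mult_upper_add mult_upper_qscale mult_upper_lam qvec.scale_right_distrib
        mult.commute)
qed

lemma mult_upper_in_V [simp, intro]: "v \<in> V g A \<Longrightarrow> mult_upper g n v \<in> V g A"
  by (fastforce simp: V_def in_keys_iff lookup_mult_upper)

lemma graded_scaleI: "v \<in> graded g A d s \<Longrightarrow> qscale c v \<in> graded g A d s"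
  unfolding graded_def by (rule qvec.span_scale)

section \<open>Construction of the two products and the Fourier map\<close>

locale basic_setup =
  fixes g :: nat and A :: "nat multiset set"
    and b :: "nat multiset \<Rightarrow> nat multiset \<Rightarrow> qvec"
  assumes adm: "admissible g A" and basic: "basic_products g A b"
begin

abbreviation l :: "nat multiset \<Rightarrow> int \<Rightarrow> qvec" where "l \<equiv> lam g A"

text \<open>The largest exponent allowed for \<open>I\<close>; the Fourier map reflects the
  exponents of \<open>I\<close> in the interval from 0 to it.\<close>

definition maxexp :: "nat multiset \<Rightarrow> nat" where "maxexp I = g - sum_mset I - 2 * size I"

lemma maxexp_le: "maxexp I \<le> g"
  by (simp add: maxexp_def)

lemma bound: "I \<in> A \<Longrightarrow> sum_mset I + 2 * size I \<le> g"
  using adm by (simp add: admissible_def)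

lemma empty_in [simp]: "{#} \<in> A"
  using adm by (simp add: admissible_def)

lemma basis_iff: "(I, m) \<in> basis_symbols g A \<longleftrightarrow> I \<in> A \<and> m \<le> maxexp I"
  using bound[of I] by (auto simp: basis_symbols_def maxexp_def)

lemma b_commute: "I \<in> A \<Longrightarrow> J \<in> A \<Longrightarrow> b I J = b J I"
  and b_graded: "I \<in> A \<Longrightarrow> J \<in> A \<Longrightarrow>
    b I J \<in> graded g A (int (size I) + int (size J)) (int (sum_mset I) + int (sum_mset J))"
  and b_empty: "I \<in> A \<Longrightarrow> b {#} I = l I 0"
  using basic by (auto simp: basic_products_def)

lemma b_in_V [simp, intro]: "I \<in> A \<Longrightarrow> J \<in> A \<Longrightarrow> b I J \<in> V g A"
  using b_graded graded_subset_V by blast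

lemma l_eq_0: "m < 0 \<or> m > int g - int (sum_mset I) - 2 * int (size I) \<Longrightarrow> l I m = 0"
  by (auto simp: lam_def basis_symbols_def)

text \<open>The product by the divided power \<open>l {#} (int k)\<close> as dictated by rule (a),
  available before \<open>star\<close> is defined; \<open>star_unit\<close> identifies the
  two.\<close>

definition shift :: "nat \<Rightarrow> qvec \<Rightarrow> qvec" where
  "shift k = extend (\<lambda>(R, m). qscale (of_nat ((m + k) choose m)) (l R (int (m + k))))"

text \<open>Rule (b) with \<open>shift\<close> in place of the outer product, which would otherwise
  make the definition circular.\<close>

definition star :: "qvec \<Rightarrow> qvec \<Rightarrow> qvec" where
  "star v w = extend (\<lambda>(I, m). extend (\<lambda>(J, h).
      qscale (of_nat ((m + h) choose m)) (shift (m + h) (b I J))) w) v"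

definition fourier :: "qvec \<Rightarrow> qvec" where
  "fourier = extend (\<lambda>(I, m). qscale ((-1) ^ m)
      (l I (int g - int (sum_mset I) - 2 * int (size I) - int m)))"

text \<open>Read off from (P2): the square of the Fourier map is, up to the sign
  \<open>(-1) ^ g\<close>, the involution \<open>mult_upper g (-1)\<close>.\<close>

definition fourier_inv :: "qvec \<Rightarrow> qvec" where
  "fourier_inv v = qscale ((-1) ^ g) (mult_upper g (-1) (fourier v))"

text \<open>The only choice compatible with the first half of (P1), the Fourier map being bijective
  on the space.\<close>

definition prd :: "qvec \<Rightarrow> qvec \<Rightarrow> qvec" where
  "prd v w = fourier (star (fourier_inv v) (fourier_inv w))"

lemma shift_add: "shift k (v + w) = shift k v + shift k w"
  and shift_qscale: "shift k (qscale c v) = qscale c (shift k v)"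
  and shift_zero [simp]: "shift k 0 = 0"
  by (simp_all add: shift_def extend_add extend_qscale)

lemma shift_in_V [simp, intro]: "shift k v \<in> V g A"
  unfolding shift_def by (rule extend_in_V) auto

lemma star_add_left: "star (v + v') w = star v w + star v' w"
  and star_qscale_left: "star (qscale c v) w = qscale c (star v w)"
  and star_zero_left [simp]: "star 0 w = 0"
  by (simp_all add: star_def extend_add extend_qscale)

lemma star_add_right: "star v (w + w') = star v w + star v w'"
  and star_qscale_right: "star v (qscale c w) = qscale c (star v w)"
  and star_zero_right [simp]: "star v 0 = 0"
  by (simp_all add: star_def extend_add extend_qscale case_prod_unfold
      extend_fun_add extend_fun_qscale extend_fun_zero)

lemma star_in_V [simp, intro]: "star v w \<in> V g A"
  unfolding star_def by (rule extend_in_V) (auto intro!: extend_in_V)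

lemma fourier_add: "fourier (v + w) = fourier v + fourier w"
  and fourier_qscale: "fourier (qscale c v) = qscale c (fourier v)"
  and fourier_zero [simp]: "fourier 0 = 0"
  by (simp_all add: fourier_def extend_add extend_qscale)

lemma fourier_in_V [simp, intro]: "fourier v \<in> V g A"
  unfolding fourier_def by (rule extend_in_V) auto

lemma fourier_inv_add: "fourier_inv (v + w) = fourier_inv v + fourier_inv w"
  and fourier_inv_qscale: "fourier_inv (qscale c v) = qscale c (fourier_inv v)"
  and fourier_inv_in_V [simp, intro]: "fourier_inv v \<in> V g A"
  by (auto simp: fourier_inv_def fourier_add fourier_qscale mult_upper_add mult_upper_qscale
      qvec.scale_right_distrib mult.commute)

lemma prd_add_left: "prd (v + v') w = prd v w + prd v' w"
  and prd_add_right: "prd v (w + w') = prd v w + prd v w'"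
  and prd_qscale_left: "prd (qscale c v) w = qscale c (prd v w)"
  and prd_qscale_right: "prd v (qscale c w) = qscale c (prd v w)"
  and prd_in_V [simp, intro]: "prd v w \<in> V g A"
  by (auto simp: prd_def fourier_add fourier_qscale fourier_inv_add fourier_inv_qscale
      star_add_left star_add_right star_qscale_left star_qscale_right)

lemma bilinear_star: "bilinear_on (V g A) star"
  by (auto simp: bilinear_on_def linear_on_def star_add_left star_add_right
      star_qscale_left star_qscale_right)

lemma bilinear_prd: "bilinear_on (V g A) prd"
  by (auto simp: bilinear_on_def linear_on_def prd_add_left prd_add_right
      prd_qscale_left prd_qscale_right)

lemma linear_fourier: "linear_on (V g A) fourier"
  by (auto simp: linear_on_def fourier_add fourier_qscale)

section \<open>The first product satisfies the extension rules\<close>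

lemma shift_lam:
  "(R, m) \<in> basis_symbols g A \<Longrightarrow>
    shift k (l R (int m)) = qscale (of_nat ((m + k) choose m)) (l R (int m + int k))"
  by (simp add: lam_int shift_def)

lemma shift_0: "v \<in> V g A \<Longrightarrow> shift 0 v = v"
  by (induction rule: V_induct) (simp_all add: shift_add shift_qscale shift_lam)

lemma star_basis:
  assumes "(I, m) \<in> basis_symbols g A" "(J, h) \<in> basis_symbols g A"
  shows "star (l I (int m)) (l J (int h)) =
    qscale (of_nat ((m + h) choose m)) (shift (m + h) (b I J))"
  using assms by (simp add: lam_int star_def)

lemma star_commute:
  assumes "v \<in> V g A" "w \<in> V g A"
  shows "star v w = star w v"
proof (rule bilinear_on_eq[OF bilinear_star _ _ assms])
  show "bilinear_on (V g A) (\<lambda>v w. star w v)"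
    using bilinear_star by (simp add: bilinear_on_def)
  fix I m J h
  assume *: "(I, m) \<in> basis_symbols g A" "(J, h) \<in> basis_symbols g A"
  have "(m + h) choose m = (h + m) choose h"
    using binomial_symmetric[of m "m + h"] by (simp add: add.commute)
  with * show "star (l I (int m)) (l J (int h)) = star (l J (int h)) (l I (int m))"
    by (simp add: star_basis b_commute[of I J] add.commute basis_iff)
qed

lemma prd_commute: "prd v w = prd w v"
  unfolding prd_def by (subst star_commute) auto

text \<open>Rule (a) is the case of rule (b) in which one multi-index is empty, because
  \<open>b {#} I\<close> is \<open>l I 0\<close>.\<close>

lemma star_unit_basis:
  assumes "({#}, k) \<in> basis_symbols g A" "(I, m) \<in> basis_symbols g A"
  shows "star (l {#} (int k)) (l I (int m)) =
    qscale (of_nat ((m + k) choose m)) (l I (int m + int k))"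
proof -
  have I: "I \<in> A" "(I, 0) \<in> basis_symbols g A" using assms by (auto simp: basis_iff)
  have "(k + m) choose k = (m + k) choose m"
    using binomial_symmetric[of m "m + k"] by (simp add: add.commute)
  then show ?thesis
    using assms I shift_lam[of I 0 "k + m"] by (simp add: star_basis b_empty algebra_simps)
qed

lemma shift_large: "v \<in> V g A \<Longrightarrow> g < k \<Longrightarrow> shift k v = 0"
  by (induction rule: V_induct) (simp_all add: shift_add shift_qscale shift_lam l_eq_0)

text \<open>Needed for every \<open>k\<close>, since \<open>m + h\<close> in rule (b) may exceed
  \<open>g\<close>; then the symbol and the shift both vanish.\<close>

lemma star_unit:
  assumes "v \<in> V g A"
  shows "star (l {#} (int k)) v = shift k v"
proof (cases "k \<le> g")
  case True
  show ?thesis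
    using assms True
    by (induction rule: V_induct)
      (simp_all add: star_add_right star_qscale_right star_unit_basis shift_lam shift_add
        shift_qscale basis_iff[of "{#}"] maxexp_def)
next
  case False
  then show ?thesis using assms by (simp add: l_eq_0 shift_large)
qed

lemma star_basic: "I \<in> A \<Longrightarrow> J \<in> A \<Longrightarrow> star (l I 0) (l J 0) = b I J"
  using star_basis[of I 0 J 0] by (simp add: basis_iff shift_0)

lemma star_lam:
  assumes "(I, m) \<in> basis_symbols g A" "(J, h) \<in> basis_symbols g A"
  shows "star (l I (int m)) (l J (int h)) =
    qscale (of_nat ((m + h) choose m)) (star (l {#} (int m + int h)) (star (l I 0) (l J 0)))"
  using assms star_unit[of "b I J" "m + h"] by (auto simp: star_basis star_basic basis_iff)

lemma extends: "extends_basic_products g A b star"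
  by unfold_locales (fact bilinear_star star_basic star_unit_basis star_lam)+

section \<open>The Fourier map and the second product\<close>

lemma fourier_lam:
  "fourier (l I m) = qscale ((-1) ^ nat m) (l I (int g - int (sum_mset I) - 2 * int (size I) - m))"
proof (cases "0 \<le> m \<and> (I, nat m) \<in> basis_symbols g A")
  case True
  then show ?thesis by (simp add: lam_def[of g A I m] fourier_def)
next
  case False
  \<comment> \<open>The reflection of exponents preserves the allowed interval, so outside it both
    sides vanish and the sign with the truncated \<open>nat m\<close> is harmless.\<close>
  then have "l I m = 0" "l I (int g - int (sum_mset I) - 2 * int (size I) - m) = 0"
    by (auto simp: lam_def basis_symbols_def)
  then show ?thesis by simp
qed

lemma fourier_fourier:
  assumes "v \<in> V g A"
  shows "fourier (fourier v) = qscale ((-1) ^ g) (mult_upper g (-1) v)"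
  using assms
proof (induction rule: V_induct)
  case zero
  then show ?case by simp
next
  case (step c I m w)
  have le: "sum_mset I + 2 * size I + m \<le> g" using step(1) by (auto simp: basis_symbols_def)
  \<comment> \<open>The signs of the two applications have exponents adding up to
    \<open>g - s - 2d\<close>, which has the parity of \<open>g + s\<close>.\<close>
  have parity: "even (m + k) \<longleftrightarrow> even (g + s)" if "k + m + 2 * d + s = g" for k d s
    using that by presburger
  have "nat (int g - int (sum_mset I) - 2 * int (size I) - int m) + m + 2 * size I + sum_mset I = g"
    using le by linarith
  then have "(-1 :: rat) ^ (m + nat (int g - int (sum_mset I) - 2 * int (size I) - int m)) =
      (-1) ^ (g + sum_mset I)"
    by (intro minus_one_power_cong) (rule parity)
  then show ?case
    using step by (simp add: fourier_add fourier_qscale mult_upper_add mult_upper_qscale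
        qvec.scale_right_distrib fourier_lam mult_upper_lam mult.left_commute
        flip: power_add)
qed

lemma mult_upper_fourier:
  "v \<in> V g A \<Longrightarrow> mult_upper g (-1) (fourier v) = fourier (mult_upper g (-1) v)"
  by (induction rule: V_induct)
    (simp_all add: fourier_add fourier_qscale mult_upper_add mult_upper_qscale fourier_lam
      mult_upper_lam mult.commute)

lemma fourier_inv_fourier: "v \<in> V g A \<Longrightarrow> fourier_inv (fourier v) = v"
  by (simp add: fourier_inv_def fourier_fourier mult_upper_qscale mult_upper_mult_upper)

lemma fourier_fourier_inv: "v \<in> V g A \<Longrightarrow> fourier (fourier_inv v) = v"
  by (simp add: fourier_inv_def fourier_qscale fourier_fourier mult_upper_qscale mult_upper_mult_upper
      flip: mult_upper_fourier)

lemma fourier_star: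
  "v \<in> V g A \<Longrightarrow> w \<in> V g A \<Longrightarrow> fourier (star v w) = prd (fourier v) (fourier w)"
  by (simp add: prd_def fourier_inv_fourier)

lemma mult_upper_shift:
  "v \<in> V g A \<Longrightarrow> mult_upper g (-1) (shift k v) = shift k (mult_upper g (-1) v)"
  by (induction rule: V_induct)
    (simp_all add: shift_add shift_qscale mult_upper_add mult_upper_qscale shift_lam
      mult_upper_lam mult.commute)

text \<open>The operator is the sign \<open>(-1) ^ s\<close> in degree \<open>s\<close>, and degrees
  add under the basic products by homogeneity.\<close>

lemma mult_upper_star:
  assumes "v \<in> V g A" "w \<in> V g A"
  shows "mult_upper g (-1) (star v w) = star (mult_upper g (-1) v) (mult_upper g (-1) w)"
proof (rule bilinear_on_eq[OF _ _ _ assms])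
  show "bilinear_on (V g A) (\<lambda>v w. mult_upper g (-1) (star v w))"
    "bilinear_on (V g A) (\<lambda>v w. star (mult_upper g (-1) v) (mult_upper g (-1) w))"
    by (auto simp: bilinear_on_def linear_on_def star_add_left star_add_right
        star_qscale_left star_qscale_right mult_upper_add mult_upper_qscale)
  fix I m J h
  assume *: "(I, m) \<in> basis_symbols g A" "(J, h) \<in> basis_symbols g A"
  then have "mult_upper g (-1) (b I J) = qscale ((-1) ^ (sum_mset I + sum_mset J)) (b I J)"
    using mult_upper_graded[OF b_graded[of I J]] by (simp add: basis_iff flip: of_nat_add)
  with * show "mult_upper g (-1) (star (l I (int m)) (l J (int h))) =
      star (mult_upper g (-1) (l I (int m))) (mult_upper g (-1) (l J (int h)))"
    by (auto simp: star_basis mult_upper_qscale mult_upper_shift shift_qscale mult_upper_lam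
        star_qscale_left star_qscale_right basis_iff power_add mult_ac)
qed

text \<open>Two Fourier maps in a row give \<open>mult_upper g (-1)\<close>, which is multiplicative
  for \<open>star\<close> and turns \<open>fourier_inv\<close> back into \<open>fourier\<close> up
  to sign. The signs of the two factors cancel and one \<open>(-1) ^ g\<close> is left.\<close>

lemma fourier_prd:
  assumes "v \<in> V g A" "w \<in> V g A"
  shows "fourier (prd v w) = qscale ((-1) ^ g) (star (fourier v) (fourier w))"
proof -
  have "fourier (prd v w) = qscale ((-1) ^ g)
      (star (mult_upper g (-1) (fourier_inv v)) (mult_upper g (-1) (fourier_inv w)))"
    by (simp add: prd_def fourier_fourier mult_upper_star)
  then show ?thesis
    by (simp add: fourier_inv_def mult_upper_qscale mult_upper_mult_upper star_qscale_left
        star_qscale_right)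
qed

lemma fourier_graded_subset: "v \<in> graded g A d s \<Longrightarrow> fourier v \<in> graded g A (int g - d - s) s"
  unfolding graded_def[of g A d s]
proof (induction rule: qvec.span_induct_alt)
  case base
  then show ?case by (simp add: graded_def qvec.span_zero)
next
  case (step c x y)
  then obtain I m where x: "x = l I m" "I \<in> A" "int (size I) + m = d" "int (sum_mset I) = s"
    by blast
  then have "l I (int g - int (sum_mset I) - 2 * int (size I) - m) \<in> graded g A (int g - d - s) s"
    unfolding graded_def
    by (intro qvec.span_base CollectI exI[of _ I]
        exI[of _ "int g - int (sum_mset I) - 2 * int (size I) - m"]) auto
  then have "qscale c (fourier x) \<in> graded g A (int g - d - s) s"
    by (simp add: x(1) fourier_lam graded_scaleI)
  with step show ?case
    by (simp add: fourier_add fourier_qscale) (simp add: graded_def qvec.span_add)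
qed

lemma fourier_graded: "fourier ` graded g A d s = graded g A (int g - d - s) s"
proof (intro equalityI subsetI)
  fix v assume v: "v \<in> graded g A (int g - d - s) s"
  \<comment> \<open>On the piece of degree \<open>s\<close> the square of the Fourier map is this
    scalar, which is its own inverse; a preimage is thus \<open>?c\<close> times
    \<open>fourier v\<close>.\<close>
  let ?c = "(-1) ^ g * (-1) ^ nat s"
  have "fourier v \<in> graded g A d s"
    using fourier_graded_subset[OF v] by simp
  then have "qscale ?c (fourier v) \<in> graded g A d s"
    by (rule graded_scaleI)
  moreover have "fourier (qscale ?c (fourier v)) = v"
    using v graded_subset_V[of g A "int g - d - s" s]
    by (subst fourier_qscale, subst fourier_fourier)
      (auto simp: mult_upper_graded mult_ac simp flip: power_add)
  ultimately show "v \<in> fourier ` graded g A d s"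
    by (metis imageI)
qed (auto simp: fourier_graded_subset)

lemma fourier_lam_basis:
  assumes "(I, m) \<in> basis_symbols g A"
  shows "fourier (l I (int m)) = qscale ((-1) ^ m) (l I (int (maxexp I - m)))"
proof -
  have "int g - int (sum_mset I) - 2 * int (size I) - int m = int (maxexp I - m)"
    using assms by (auto simp: basis_symbols_def maxexp_def)
  then show ?thesis
    unfolding fourier_lam by (simp only: nat_int)
qed

text \<open>Writing symbols as Fourier images lets \<open>fourier_star\<close> turn their second
  product into a first product.\<close>

lemma lam_eq_fourier:
  assumes "(I, m) \<in> basis_symbols g A"
  shows "l I (int m) = qscale ((-1) ^ (maxexp I - m)) (fourier (l I (int (maxexp I - m))))"
proof -
  have "(I, maxexp I - m) \<in> basis_symbols g A" "maxexp I - (maxexp I - m) = m"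
    using assms by (auto simp: basis_iff)
  then show ?thesis by (simp add: fourier_lam_basis del: of_nat_diff)
qed

lemma prd_lam:
  assumes "(I, t) \<in> basis_symbols g A" "(J, k) \<in> basis_symbols g A"
  shows "prd (l I (int t)) (l J (int k)) =
    qscale ((-1) ^ (maxexp I - t + (maxexp J - k)) * of_nat ((maxexp I - t + (maxexp J - k)) choose (maxexp I - t)))
      (fourier (shift (maxexp I - t + (maxexp J - k)) (b I J)))"
proof -
  have "(I, maxexp I - t) \<in> basis_symbols g A" "(J, maxexp J - k) \<in> basis_symbols g A"
    using assms by (auto simp: basis_iff)
  then show ?thesis
    by (subst lam_eq_fourier[OF assms(1)], subst lam_eq_fourier[OF assms(2)])
      (simp add: prd_qscale_left prd_qscale_right fourier_qscale star_basis power_add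
        flip: fourier_star)
qed

lemma unit_prd_lam:
  assumes "({#}, k) \<in> basis_symbols g A" "(I, m) \<in> basis_symbols g A"
  shows "prd (l {#} (int k)) (l I (int m)) =
    qscale (of_nat ((2 * g - m - k - sum_mset I - 2 * size I) choose (g - k)))
      (l I (int m - int g + int k))"
proof -
  have I: "I \<in> A" "(I, 0) \<in> basis_symbols g A" using assms by (auto simp: basis_iff)
  have le: "sum_mset I + 2 * size I + m \<le> g" "k \<le> g"
    using assms by (auto simp: basis_symbols_def)
  \<comment> \<open>The sum of the complementary exponents: on the Fourier side the product is one
    of exponents \<open>g - k\<close> and \<open>maxexp I - m\<close>. The sign
    \<open>(-1) ^ n\<close> cancels when transforming back.\<close>
  define n where "n = g - k + (maxexp I - m)"
  have n: "2 * g - m - k - sum_mset I - 2 * size I = n"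
    "int g - int (sum_mset I) - 2 * int (size I) - int n = int m - int g + int k"
    "maxexp {#} - k + (maxexp I - m) = n" "maxexp {#} - k = g - k"
    using le by (simp_all add: n_def maxexp_def)
  show ?thesis
    using shift_lam[OF I(2), of n] I
    unfolding prd_lam[OF assms] n(1,3) unfolding n(4)
    by (simp add: b_empty fourier_lam n(2))
qed

text \<open>No bound on \<open>n\<close> is imposed: in \<open>lam_prd_lam\<close> it may exceed
  \<open>g\<close>, and then both sides are zero.\<close>

lemma unit_prd_fourier:
  assumes "v \<in> V g A"
  shows "prd (l {#} (int g - int n)) (fourier v) = qscale ((-1) ^ n) (fourier (shift n v))"
proof -
  have "fourier (shift n v) = prd (fourier (l {#} (int n))) (fourier v)"
    using assms by (simp add: star_unit flip: fourier_star)
  then show ?thesis by (simp add: fourier_lam prd_qscale_left)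
qed

lemma lam_prd_lam:
  assumes "(I, t) \<in> basis_symbols g A" "(J, k) \<in> basis_symbols g A"
  shows "prd (l I (int t)) (l J (int k)) =
    qscale (of_nat ((maxexp I - t + (maxexp J - k)) choose (maxexp I - t)))
      (prd (l {#} (int g - int (maxexp I) + int t - int (maxexp J) + int k))
        (prd (l I (int (maxexp I))) (l J (int (maxexp J)))))"
proof -
  let ?n = "maxexp I - t + (maxexp J - k)"
  have *: "I \<in> A" "J \<in> A" "t \<le> maxexp I" "k \<le> maxexp J" using assms by (auto simp: basis_iff)
  have n: "int g - int (maxexp I) + int t - int (maxexp J) + int k = int g - int ?n"
    using * bound[of I] bound[of J] by (simp add: maxexp_def)
  \<comment> \<open>The symbols of top exponent are the Fourier images of \<open>l I 0\<close> and
    \<open>l J 0\<close>.\<close>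
  have top: "prd (l I (int (maxexp I))) (l J (int (maxexp J))) = fourier (b I J)"
    using prd_lam[of I "maxexp I" J "maxexp J"] * by (simp add: basis_iff shift_0)
  show ?thesis
    unfolding n top prd_lam[OF assms] unit_prd_fourier[OF b_in_V[OF *(1,2)]]
    by (simp add: mult.commute)
qed

section \<open>The exponential formula through binary forms\<close>

text \<open>
  For fixed \<open>I\<close>, evaluating \<open>\<lambda>\<^bsub>I\<^esub>\<^bsup>[m]\<^esup>\<close> as
  \<open>x\<^bsup>m\<^esup> y\<^bsup>n - m\<^esup> / (m! (n - m)!)\<close> with \<open>n = maxexp I\<close> turns
  \<open>\<star> e\<^bsup>-\<Theta>\<^esup>\<close> into the substitution \<open>y := y - x\<close> (up to sign), the Fourier map into
  \<open>(x, y) := (- y, x)\<close>, and hence \<open>\<cdot> e\<^bsup>\<Theta>\<^esup>\<close> into \<open>x := x + y\<close>.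
\<close>

definition ev :: "nat multiset \<Rightarrow> rat \<Rightarrow> rat \<Rightarrow> qvec \<Rightarrow> rat" where
  "ev I x y v = (\<Sum>m\<le>maxexp I. Poly_Mapping.lookup v (I, m) *
      (x ^ m * y ^ (maxexp I - m) / (fact m * fact (maxexp I - m))))"

lemma ev_add: "ev I x y (v + w) = ev I x y v + ev I x y w"
  by (simp add: ev_def lookup_add distrib_right add_divide_distrib sum.distrib)

lemma ev_qscale: "ev I x y (qscale c v) = c * ev I x y v"
  by (simp add: ev_def lookup_qscale sum_distrib_left mult.assoc)

lemma ev_zero [simp]: "ev I x y 0 = 0"
  by (simp add: ev_def)

lemma ev_sum: "ev I x y (sum f S) = (\<Sum>i\<in>S. ev I x y (f i))"
  by (induction S rule: infinite_finite_induct) (simp_all add: ev_add)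

lemma ev_lam:
  "I \<in> A \<Longrightarrow> ev I x y (l J (int m)) =
    (if J = I \<and> m \<le> maxexp I then x ^ m * y ^ (maxexp I - m) / (fact m * fact (maxexp I - m)) else 0)"
  by (auto simp: ev_def lam_int basis_iff lookup_single when_def
      if_distrib[of "\<lambda>z. z * t" for t] if_distrib[of "\<lambda>z. z / t" for t] cong: if_cong)

text \<open>At \<open>y = 1\<close> the evaluation is a polynomial function of \<open>x\<close>
  whose coefficients are those of the vector up to nonzero factorials. Over the rationals such a
  function determines its coefficients.\<close>

lemma ev_injective:
  assumes v: "v \<in> V g A" and w: "w \<in> V g A"
    and eq: "\<And>I x y. I \<in> A \<Longrightarrow> ev I x y v = ev I x y w"
  shows "v = w"
proof (rule poly_mapping_eqI)
  fix p :: "nat multiset \<times> nat"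
  obtain I m where p: "p = (I, m)" by (cases p)
  show "Poly_Mapping.lookup v p = Poly_Mapping.lookup w p"
  proof (cases "p \<in> basis_symbols g A")
    case False
    then have "p \<notin> Poly_Mapping.keys v" "p \<notin> Poly_Mapping.keys w"
      using v w by (auto simp: V_def)
    then show ?thesis by (simp add: in_keys_iff)
  next
    case True
    let ?c = "\<lambda>u m. Poly_Mapping.lookup u (I, m) / (fact m * fact (maxexp I - m)) :: rat"
    let ?P = "\<lambda>u. \<Sum>m\<le>maxexp I. monom (?c u m) m"
    have ev: "ev I x 1 u = poly (?P u) x" for x u
      by (simp add: ev_def poly_sum poly_monom)
    have "poly (?P v) = poly (?P w)"
      using eq[of I _ 1] True by (simp add: fun_eq_iff ev p basis_iff)
    then have "coeff (?P v) m = coeff (?P w) m"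
      by (simp only: poly_eq_poly_eq_iff)
    moreover have "coeff (?P u) m = ?c u m" for u
      using True by (simp add: coeff_sum p basis_iff)
    ultimately show ?thesis by (simp add: p)
  qed
qed

lemma ev_mult_upper:
  assumes "I \<in> A" "v \<in> V g A"
  shows "ev I x y (mult_upper g (-1) v) = (-1) ^ sum_mset I * ev I x y v"
  using assms(2)
  by (induction rule: V_induct)
    (auto simp: mult_upper_add mult_upper_qscale mult_upper_lam ev_add ev_qscale
      ev_lam[OF assms(1)] distrib_left)

lemma ev_fourier:
  assumes "I \<in> A" "v \<in> V g A"
  shows "ev I x y (fourier v) = ev I (- y) x v"
  using assms(2)
proof (induction rule: V_induct)
  case zero
  then show ?case by simp
next
  case (step c J m w)
  have "fourier (l J (int m)) = qscale ((-1) ^ m) (l J (int (maxexp J - m)))"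
    using step(1) by (intro fourier_lam_basis)
  then show ?case
    using step
    by (auto simp: fourier_add fourier_qscale ev_add ev_qscale ev_lam[OF assms(1)]
        basis_iff power_minus[of y] mult_ac simp del: of_nat_diff)
qed

text \<open>Summed by the exponent of the symbol, so that each term acts as a shift by the summation
  index.\<close>

lemma exp_Theta_minus: "exp_Theta g A (-1) = (\<Sum>j\<le>g. qscale ((-1) ^ (g + j)) (l {#} (int j)))"
  unfolding exp_Theta_def
  by (rule sum.reindex_bij_witness[of _ "\<lambda>j. g - j" "\<lambda>j. g - j"])
    (auto simp: minus_one_power_iff of_nat_diff)

text \<open>The Fourier sign \<open>(-1) ^ j\<close> cancels the alternating one. Hence the second
  product by one exponential is conjugate to the first product by the other.\<close>

lemma fourier_exp_Theta: "fourier (exp_Theta g A (-1)) = qscale ((-1) ^ g) (exp_Theta g A 1)"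
proof -
  have *: "fourier (sum f S) = (\<Sum>i\<in>S. fourier (f i))" for f and S :: "nat set"
    by (induction S rule: infinite_finite_induct) (simp_all add: fourier_add)
  show ?thesis
    unfolding exp_Theta_minus *
    by (simp add: exp_Theta_def fourier_qscale fourier_lam power_add mult.assoc
        qvec.scale_sum_right atMost_atLeast0)
qed

lemma exp_Theta_in_V [simp, intro]: "exp_Theta g A e \<in> V g A"
  by (auto simp: exp_Theta_def)

lemma star_sum_left: "star (sum f S) w = (\<Sum>i\<in>S. star (f i) w)"
  by (induction S rule: infinite_finite_induct) (simp_all add: star_add_left)

text \<open>The binomial theorem for \<open>(y - x) ^ (n - m)\<close>, after the factorials are
  regrouped into \<open>(n - m) choose j\<close>.\<close>

lemma binomial_shift:
  fixes x y :: rat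
  assumes "m \<le> n"
  shows "(\<Sum>j\<le>n - m. (-1) ^ j * of_nat ((m + j) choose m) *
      (x ^ (m + j) * y ^ (n - (m + j)) / (fact (m + j) * fact (n - (m + j))))) =
    x ^ m * (y - x) ^ (n - m) / (fact m * fact (n - m))"
proof -
  have "(-1) ^ j * of_nat ((m + j) choose m) *
      (x ^ (m + j) * y ^ (n - (m + j)) / (fact (m + j) * fact (n - (m + j)))) =
    x ^ m / (fact m * fact (n - m)) * (of_nat ((n - m) choose j) * (- x) ^ j * y ^ (n - m - j))"
    if "j \<le> n - m" for j
    using that assms
    by (simp add: binomial_fact power_add power_minus[of x] divide_simps)
  then have "(\<Sum>j\<le>n - m. (-1) ^ j * of_nat ((m + j) choose m) *
      (x ^ (m + j) * y ^ (n - (m + j)) / (fact (m + j) * fact (n - (m + j))))) =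
      x ^ m / (fact m * fact (n - m)) *
        (\<Sum>j\<le>n - m. of_nat ((n - m) choose j) * (- x) ^ j * y ^ (n - m - j))"
    by (simp add: sum_distrib_left)
  also have "\<dots> = x ^ m / (fact m * fact (n - m)) * (- x + y) ^ (n - m)"
    by (simp only: binomial_ring)
  finally show ?thesis by simp
qed

lemma ev_star_exp:
  assumes "I \<in> A" "v \<in> V g A"
  shows "ev I x y (star v (exp_Theta g A (-1))) = (-1) ^ g * ev I x (y - x) v"
  using assms(2)
proof (induction rule: V_induct)
  case zero
  then show ?case by simp
next
  case (step c J m w)
  have J: "J \<in> A" "m \<le> maxexp J" using step(1) by (auto simp: basis_iff)
  have "ev I x y (star (l J (int m)) (exp_Theta g A (-1))) =
      (\<Sum>j\<le>g. (-1) ^ (g + j) * of_nat ((m + j) choose m) * ev I x y (l J (int (m + j))))"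
    using step(1)
    by (subst star_commute)
      (auto simp: exp_Theta_minus star_sum_left star_qscale_left star_unit shift_lam ev_sum
        ev_qscale mult.assoc)
  also have "\<dots> = (-1) ^ g * ev I x (y - x) (l J (int m))"
  proof (cases "J = I")
    case False
    then show ?thesis by (simp add: ev_lam[OF assms(1)] del: of_nat_add)
  next
    case True
    \<comment> \<open>Terms with \<open>m + j\<close> beyond \<open>maxexp I\<close> vanish.\<close>
    have "(\<Sum>j\<le>g. (-1) ^ (g + j) * of_nat ((m + j) choose m) * ev I x y (l J (int (m + j)))) =
        (\<Sum>j\<le>maxexp I - m. (-1) ^ (g + j) * of_nat ((m + j) choose m) *
          ev I x y (l J (int (m + j))))"
      using J True maxexp_le[of I]
      by (intro sum.mono_neutral_right) (auto simp: ev_lam simp del: of_nat_add)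
    also have "\<dots> = (-1) ^ g * (\<Sum>j\<le>maxexp I - m. (-1) ^ j * of_nat ((m + j) choose m) *
      (x ^ (m + j) * y ^ (maxexp I - (m + j)) / (fact (m + j) * fact (maxexp I - (m + j)))))"
      unfolding sum_distrib_left using J True
      by (intro sum.cong) (auto simp: ev_lam power_add simp del: of_nat_add)
    also have "\<dots> = (-1) ^ g *
        (x ^ m * (y - x) ^ (maxexp I - m) / (fact m * fact (maxexp I - m)))"
      using J True by (subst binomial_shift) simp_all
    finally show ?thesis
      using J True by (simp add: ev_lam)
  qed
  finally show ?case
    using step by (simp add: star_add_left star_qscale_left ev_add ev_qscale distrib_left)
qed

text \<open>Conjugating by the Fourier map: for \<open>v = fourier u\<close> both sides are the
  value of \<open>u\<close> at \<open>(- y, x + y)\<close>.\<close>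

lemma ev_prd_exp:
  assumes "I \<in> A" "v \<in> V g A"
  shows "ev I x y (prd v (exp_Theta g A 1)) = ev I (x + y) y v"
proof -
  define u where "u = fourier_inv v"
  have u: "u \<in> V g A" "v = fourier u"
    using assms(2) by (simp_all add: u_def fourier_fourier_inv)
  have "exp_Theta g A 1 = qscale ((-1) ^ g) (fourier (exp_Theta g A (-1)))"
    by (simp add: fourier_exp_Theta)
  then have "prd v (exp_Theta g A 1) = qscale ((-1) ^ g) (fourier (star u (exp_Theta g A (-1))))"
    using u by (simp add: prd_qscale_right fourier_star)
  then show ?thesis
    using assms(1) u by (simp add: ev_qscale ev_fourier ev_star_exp flip: mult.assoc)
qed

lemma ev_uminus:
  assumes "I \<in> A"
  shows "ev I (- x) (- y) v = (-1) ^ maxexp I * ev I x y v"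
proof -
  have "(- x) ^ m * (- y) ^ (maxexp I - m) = (-1) ^ maxexp I * (x ^ m * y ^ (maxexp I - m))"
    if "m \<le> maxexp I" for m
  proof -
    have "(-1 :: rat) ^ maxexp I = (-1) ^ m * (-1) ^ (maxexp I - m)"
      using that by (simp flip: power_add)
    then show ?thesis
      by (simp add: power_minus[of x] power_minus[of y] mult_ac)
  qed
  then show ?thesis
    by (simp add: ev_def sum_distrib_left mult_ac)
qed

text \<open>The three substitutions carry \<open>(x, y)\<close> to \<open>(x + y, y)\<close>, then
  \<open>(x + y, - x)\<close>, then \<open>(y, - x)\<close>, which is the negative of the Fourier
  substitution \<open>(- y, x)\<close>. By homogeneity this costs \<open>(-1) ^ maxexp I\<close>,
  the product of the sign \<open>(-1) ^ g\<close> from \<open>ev_star_exp\<close> and the sign of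
  \<open>mult_upper\<close>.\<close>

lemma fourier_exp:
  assumes "W \<in> V g A"
  shows "fourier W = prd (exp_Theta g A 1)
    (star (prd (mult_upper g (-1) W) (exp_Theta g A 1)) (exp_Theta g A (-1)))"
proof (rule ev_injective)
  fix I x y assume I: "I \<in> A"
  have parity: "even (g - s - 2 * d) \<longleftrightarrow> even (g + s)" if "s + 2 * d \<le> g" for s d
    using that by presburger
  have "(-1 :: rat) ^ maxexp I = (-1) ^ (g + sum_mset I)"
    using bound[OF I] unfolding maxexp_def by (intro minus_one_power_cong parity)
  then show "ev I x y (fourier W) = ev I x y (prd (exp_Theta g A 1)
      (star (prd (mult_upper g (-1) W) (exp_Theta g A 1)) (exp_Theta g A (-1))))"
    using I assms ev_uminus[OF I, of y "- x"]
    by (subst prd_commute)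
      (simp add: ev_prd_exp ev_star_exp ev_mult_upper ev_fourier power_add)
qed auto

section \<open>Existence\<close>

lemma fourier_structure: "fourier_structure g A b star prd fourier"
proof -
  interpret extends_basic_products g A b star by (fact extends)
  show ?thesis
  proof
    fix I and m' :: int
    assume "I \<in> A"
    then show "l I m' \<noteq> 0 \<longleftrightarrow>
        0 \<le> m' \<and> m' \<le> int g - int (sum_mset I) - 2 * int (size I)"
      by (auto simp: lam_def basis_symbols_def single_one_nonzero)
  next
    fix I assume "l I 0 \<noteq> 0"
    then show "sum_mset I + 2 * size I \<le> g"
      by (auto simp: lam_def basis_symbols_def split: if_splits)
  next
    fix I J t k i' j'
    assume "(I, t) \<in> basis_symbols g A" "(J, k) \<in> basis_symbols g A"
      "i' = g - sum_mset I - 2 * size I" "j' = g - sum_mset J - 2 * size J"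
    then show "prd (l I (int t)) (l J (int k)) =
        qscale (of_nat ((i' - t + (j' - k)) choose (i' - t)))
          (prd (l {#} (int g - int i' + int t - int j' + int k))
            (prd (l I (int i')) (l J (int j'))))"
      by (simp only: lam_prd_lam flip: maxexp_def)
  qed (auto simp: bilinear_prd linear_fourier fourier_star fourier_prd fourier_fourier
      fourier_graded fourier_lam unit_prd_lam star_unit_basis
      intro: fourier_exp star_lam)
qed

end

section \<open>Uniqueness\<close>

lemma extends_unique:
  assumes S: "extends_basic_products g A b star" and S': "extends_basic_products g A b star'"
    and v: "v \<in> V g A" and w: "w \<in> V g A"
  shows "star' v w = star v w"
proof -
  interpret S: extends_basic_products g A b star by fact
  interpret S': extends_basic_products g A b star' by fact
  \<comment> \<open>Rule (b) reduces everything to products by \<open>lam g A {#} (int k)\<close>,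
    which rule (a) fixes. Here too \<open>k\<close> may exceed \<open>g\<close>, and bilinearity
    then gives zero.\<close>
  have unit: "star' (lam g A {#} (int k)) u = star (lam g A {#} (int k)) u"
    if "u \<in> V g A" for u k
  proof (rule linear_on_eq[OF _ _ _ that])
    show "linear_on (V g A) (star' (lam g A {#} (int k)))"
      "linear_on (V g A) (star (lam g A {#} (int k)))"
      using S.bilinear_star S'.bilinear_star by (simp_all add: bilinear_on_def)
    fix I m assume I: "(I, m) \<in> basis_symbols g A"
    show "star' (lam g A {#} (int k)) (lam g A I (int m)) =
        star (lam g A {#} (int k)) (lam g A I (int m))"
    proof (cases "({#}, k) \<in> basis_symbols g A")
      case True
      with I show ?thesis by (simp add: S.star_unit S'.star_unit)
    next
      case False
      have zero: "T 0 u = 0" if "bilinear_on (V g A) T" "u \<in> V g A" for T u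
        using linear_on_zero[of g A "\<lambda>v. T v u"] that by (simp add: bilinear_on_def)
      then show ?thesis
        using False zero[OF S.bilinear_star] zero[OF S'.bilinear_star]
        by (simp add: lam_int[of g A "{#}"])
    qed
  qed
  show ?thesis
  proof (rule bilinear_on_eq[OF S'.bilinear_star S.bilinear_star _ v w])
    fix I m J h
    assume *: "(I, m) \<in> basis_symbols g A" "(J, h) \<in> basis_symbols g A"
    then have IJ: "I \<in> A" "J \<in> A" by (auto simp: basis_symbols_def)
    have "star (lam g A I 0) (lam g A J 0) \<in> V g A"
      using S.bilinear_star by (auto simp: bilinear_on_def linear_on_def)
    then show "star' (lam g A I (int m)) (lam g A J (int h)) =
        star (lam g A I (int m)) (lam g A J (int h))"
      using * IJ unit[of _ "m + h"]
      by (simp add: S.star_lam S'.star_lam S.star_basic S'.star_basic)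
  qed
qed

lemma fourier_structure_unique:
  assumes S: "fourier_structure g A b star prd F" and S': "fourier_structure g A b star' prd' F'"
    and v: "v \<in> V g A" and w: "w \<in> V g A"
  shows "star' v w = star v w" "prd' v w = prd v w" "F' v = F v"
proof -
  interpret S: fourier_structure g A b star prd F by fact
  interpret S': fourier_structure g A b star' prd' F' by fact
  have star: "star' v w = star v w" if "v \<in> V g A" "w \<in> V g A" for v w
    by (rule extends_unique[OF _ _ that]) unfold_locales
  have F: "F' v = F v" if "v \<in> V g A" for v
    by (rule linear_on_eq[OF S'.linear_F S.linear_F _ that]) (simp add: S.F_lam S'.F_lam)
  show "star' v w = star v w" "F' v = F v" using v w by (simp_all add: star F)
  \<comment> \<open>By (P2) every vector has an explicit preimage under \<open>F\<close>. With (P7)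
    fixing \<open>F\<close>, (P1) then determines the second product from the first.\<close>
  have sgn: "u = F (qscale ((-1) ^ g) (F (mult_upper g (-1) u)))" if "u \<in> V g A" for u
    using that S.linear_F S.F_F[of "mult_upper g (-1) u"]
    by (simp add: linear_on_def mult_upper_mult_upper)
  have "\<exists>u\<in>V g A. v = F u" if "v \<in> V g A" for v
  proof -
    have "F (mult_upper g (-1) v) \<in> V g A"
      using that S.linear_F by (simp add: linear_on_def)
    then have "qscale ((-1) ^ g) (F (mult_upper g (-1) v)) \<in> V g A" by simp
    with sgn[OF that] show ?thesis by blast
  qed
  then obtain v0 w0 where 0: "v0 \<in> V g A" "w0 \<in> V g A" "v = F v0" "w = F w0"
    using v w by metis
  then have "F' v0 = v" "F' w0 = w" by (simp_all add: F)
  moreover have "star v0 w0 \<in> V g A"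
    using S.bilinear_star 0(1,2) unfolding bilinear_on_def linear_on_def by blast
  ultimately show "prd' v w = prd v w"
    using S.F_star[OF 0(1,2)] S'.F_star[OF 0(1,2)] 0 star[OF 0(1,2)] F by metis
qed

theorem proposition27:
  fixes g :: nat and A :: "nat multiset set"
    and b :: "nat multiset \<Rightarrow> nat multiset \<Rightarrow> qvec"
  assumes "1 \<le> g"
    and "admissible g A"
    and "basic_products g A b"
    and assoc: "\<And>star I J R.
      \<lbrakk>extends_basic_products g A b star; I \<in> A; J \<in> A; R \<in> A\<rbrakk> \<Longrightarrow>
        star (star (lam g A I 0) (lam g A J 0)) (lam g A R 0) =
        star (lam g A I 0) (star (lam g A J 0) (lam g A R 0))"
  shows "\<exists>star prd F.
      fourier_structure g A b star prd F \<and>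
      (\<forall>star' prd' F'. fourier_structure g A b star' prd' F' \<longrightarrow>
        (\<forall>\<alpha>\<in>V g A. \<forall>\<beta>\<in>V g A. star' \<alpha> \<beta> = star \<alpha> \<beta> \<and> prd' \<alpha> \<beta> = prd \<alpha> \<beta>) \<and>
        (\<forall>\<alpha>\<in>V g A. F' \<alpha> = F \<alpha>))"
proof -
  interpret basic_setup g A b using assms by unfold_locales
  show ?thesis
  proof (intro exI conjI allI impI ballI)
    show "fourier_structure g A b star prd fourier" by (rule fourier_structure)
  qed (rule fourier_structure_unique[OF fourier_structure]; assumption)+
qed

end
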